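(* Let $\mathscr{C}$ be a nonempty weakly compact convex subset of a Banach space $\mathcal{E}$, and let $f\colon\mathscr{C}\to\mathscr{C}$ be a demicontinuous mapping. Suppose that the iterate $f^m$ is strongly continuous for some $m\in\mathbb{N}$, $m\ge 1$. Then $f$ has a fixed point.
   Context: A mapping $f\colon\mathscr{C}\to\mathscr{C}$ is demicontinuous if it maps strongly (norm) convergent sequences into weakly convergent sequences, i.e. $x_n\to x$ in norm with $x_n,x\in\mathscr{C}$ implies $f(x_n)\rightharpoonup f(x)$ weakly. $f^m$ denotes the $m$-fold composition of $f$ with itself. $f^m$ is strongly continuous if $f^m(x_n)\to f^m(x)$ in norm whenever $x_n,x\in\mathscr{C}$ and $x_n\rightharpoonup x$ weakly. *)

theory Defs
  imports "HOL-Analysis.Analysis"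
begin

text \<open>The coarsest topology making every continuous linear functional continuous. Real-valued
  functionals suffice: over complex scalars, \<open>\<phi> \<mapsto> Re \<phi>\<close> is a bijection from the complex dual onto
  the dual of the underlying real space, and both duals induce the same topology.\<close>

definition weak_topology :: "'a::real_normed_vector topology" where
  "weak_topology =
     topology_generated_by {\<phi> -` U | (\<phi> :: 'a \<Rightarrow> real) U. bounded_linear \<phi> \<and> open U}"

lemma topspace_weak_topology [simp]: "topspace weak_topology = UNIV"
proof -
  have "(UNIV :: 'a set) \<in> {\<phi> -` U | (\<phi> :: 'a \<Rightarrow> real) U. bounded_linear \<phi> \<and> open U}"
    using bounded_linear_zero[where ?'a = 'a and ?'b = real] open_UNIV by blast
  then show ?thesis
    unfolding weak_topology_def topology_generated_by_topspace by blast
qed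

lemma limitin_weak_topology_iff:
  "limitin weak_topology X x F \<longleftrightarrow>
     (\<forall>\<phi> :: 'a::real_normed_vector \<Rightarrow> real. bounded_linear \<phi> \<longrightarrow> ((\<lambda>i. \<phi> (X i)) \<longlongrightarrow> \<phi> x) F)"
    (is "?L \<longleftrightarrow> ?R")
proof
  assume L: ?L
  show ?R
  proof (intro allI impI topological_tendstoI)
    fix \<phi> :: "'a \<Rightarrow> real" and U :: "real set"
    assume "bounded_linear \<phi>" "open U" "\<phi> x \<in> U"
    then have "openin weak_topology (\<phi> -` U)" "x \<in> \<phi> -` U"
      unfolding weak_topology_def by (auto intro!: topology_generated_by_Basis)
    with L have "\<forall>\<^sub>F i in F. X i \<in> \<phi> -` U"
      unfolding limitin_def by blast
    then show "\<forall>\<^sub>F i in F. \<phi> (X i) \<in> U"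
      by simp
  qed
next
  assume R: ?R
  have "x \<in> W \<longrightarrow> (\<forall>\<^sub>F i in F. X i \<in> W)"
    if "generate_topology_on {\<phi> -` U | (\<phi> :: 'a \<Rightarrow> real) U. bounded_linear \<phi> \<and> open U} W" for W
    using that
  proof induction
    case (UN K)
    show ?case
    proof
      assume "x \<in> \<Union>K"
      then obtain k where "k \<in> K" "x \<in> k" by blast
      then have "\<forall>\<^sub>F i in F. X i \<in> k" using UN by blast
      then show "\<forall>\<^sub>F i in F. X i \<in> \<Union>K"
        by (rule eventually_mono) (use \<open>k \<in> K\<close> in blast)
    qed
  next
    case (Basis s)
    then obtain \<phi> :: "'a \<Rightarrow> real" and U where s: "s = \<phi> -` U" "bounded_linear \<phi>" "open U"
      by blast
    then have "((\<lambda>i. \<phi> (X i)) \<longlongrightarrow> \<phi> x) F"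
      using R by blast
    then show ?case
      using s by (auto dest: topological_tendstoD)
  qed (auto intro: eventually_conj)
  then show ?L
    unfolding limitin_def topspace_weak_topology
    by (auto simp: weak_topology_def openin_topology_generated_by_iff)
qed

definition demicontinuous_on :: "'a::real_normed_vector set \<Rightarrow> ('a \<Rightarrow> 'a) \<Rightarrow> bool" where
  "demicontinuous_on C f \<longleftrightarrow>
     (\<forall>X x. (\<forall>n::nat. X n \<in> C) \<and> x \<in> C \<and> X \<longlonglongrightarrow> x \<longrightarrow>
        limitin weak_topology (\<lambda>n. f (X n)) (f x) sequentially)"

definition strongly_continuous_on :: "'a::real_normed_vector set \<Rightarrow> ('a \<Rightarrow> 'a) \<Rightarrow> bool" where
  "strongly_continuous_on C f \<longleftrightarrow>
     (\<forall>X x. (\<forall>n::nat. X n \<in> C) \<and> x \<in> C \<and> limitin weak_topology X x sequentially \<longrightarrow>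
        (\<lambda>n. f (X n)) \<longlonglongrightarrow> f x)"

end

theory Submission
  imports Defs
begin

text \<open>If \<open>x\<^sub>n\<close> and \<open>f x\<^sub>n\<close> both converge weakly to \<open>x\<close>, then \<open>f\<^sup>m x\<^sub>n\<close> and \<open>f (f\<^sup>m x\<^sub>n) = f\<^sup>m (f x\<^sub>n)\<close> both
  converge in norm to \<open>z = f\<^sup>m x\<close>, and demicontinuity gives \<open>f z = z\<close>. Such a weak approximate fixed point
  sequence exists for every demicontinuous self-map of a weakly compact convex set. For finitely many
  functionals, let \<open>F\<close> be a finite net of the set with respect to the seminorm they define;
  Brouwer's theorem applied to \<open>f\<close> restricted to the hull of \<open>F\<close> and followed by a Schauder projection onto
  that hull yields a point that these functionals nearly fail to separate from its image. On a
  separable invariant convex subset countably many functionals separate points and thus metrize the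
  weak topology, which lets one pass to a sequence.\<close>

subsection \<open>Sublinear functionals and separation\<close>

text \<open>Homogeneity is required only as an inequality for positive scalars, which is easier to
  verify for infima; equality, and the value 0 at 0, follow.\<close>

definition sublinear :: "('a::real_vector \<Rightarrow> real) \<Rightarrow> bool" where
  "sublinear p \<longleftrightarrow> (\<forall>x y. p (x + y) \<le> p x + p y) \<and> (\<forall>c>0. \<forall>x. p (c *\<^sub>R x) \<le> c * p x)"

lemma sublinearD:
  assumes "sublinear p"
  shows "p (x + y) \<le> p x + p y"
    and "c > 0 \<Longrightarrow> p (c *\<^sub>R x) \<le> c * p x"
    and "p 0 = 0"
    and "- p (- x) \<le> p x"
    and "c > 0 \<Longrightarrow> p (c *\<^sub>R x) = c * p x"
proof -
  show add: "p (x + y) \<le> p x + p y" for x y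
    using assms unfolding sublinear_def by blast
  show scale: "p (c *\<^sub>R x) \<le> c * p x" if "c > 0" for c x
    using assms that unfolding sublinear_def by blast
  show zero: "p 0 = 0"
    using add[of 0 0] scale[of "1/2" 0] by simp
  show "- p (- x) \<le> p x"
    using add[of x "- x"] zero by simp
  show "p (c *\<^sub>R x) = c * p x" if "c > 0"
  proof (rule antisym)
    have "p x \<le> inverse c * p (c *\<^sub>R x)"
      using scale[of "inverse c" "c *\<^sub>R x"] that by simp
    then show "c * p x \<le> p (c *\<^sub>R x)"
      using that by (simp add: field_simps)
  qed (use scale that in blast)
qed

lemma sublinear_norm: "sublinear norm"
  by (simp add: sublinear_def norm_triangle_ineq)

text \<open>With \<open>K\<close> a singleton this gives linearity of minimal sublinear functionals; with \<open>p = norm\<close>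
  it separates a point from a convex set.\<close>

lemma sublinear_lower_on_convex:
  assumes p: "sublinear p" and K: "convex K" "K \<noteq> {}" and r: "\<And>d. d \<in> K \<Longrightarrow> r \<le> p d"
  obtains q where "sublinear q" "\<And>x. q x \<le> p x" "\<And>d. d \<in> K \<Longrightarrow> q (- d) \<le> - r"
proof -
  \<comment> \<open>A move of length \<open>t\<close> along \<open>K\<close> is credited with
    \<open>t * r\<close>: the choice \<open>t = 0\<close> gives \<open>q \<le> p\<close>, and
    \<open>t = 1\<close> at \<open>- d\<close> gives \<open>q (- d) \<le> - r\<close>.\<close>
  define S where "S x = {p (x + t *\<^sub>R d) - t * r | t d. 0 \<le> t \<and> d \<in> K}" for x
  define q where "q x = Inf (S x)" for x
  have S_ne: "S x \<noteq> {}" for x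
    using K(2) unfolding S_def by (auto intro: order_refl)
  \<comment> \<open>A lower bound independent of \<open>t\<close> and \<open>d\<close>, which keeps
    the infimum finite.\<close>
  have low: "- p (- x) \<le> p (x + t *\<^sub>R d) - t * r" if "0 \<le> t" "d \<in> K" for x t d
  proof -
    have "t * r \<le> p (t *\<^sub>R d)"
    proof (cases "t = 0")
      case False
      then show ?thesis
        using sublinearD(5)[OF p, of t d] that r by simp
    qed (simp add: sublinearD(3)[OF p])
    also have "\<dots> \<le> p (x + t *\<^sub>R d) + p (- x)"
      using sublinearD(1)[OF p, of "x + t *\<^sub>R d" "- x"] by simp
    finally show ?thesis by simp
  qed
  have bdd: "bdd_below (S x)" for x
    unfolding S_def by (intro bdd_belowI[where m = "- p (- x)"]) (use low in auto)
  have q_le: "q x \<le> p (x + t *\<^sub>R d) - t * r" if "0 \<le> t" "d \<in> K" for x t d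
    unfolding q_def by (rule cInf_lower[OF _ bdd]) (use that in \<open>auto simp: S_def\<close>)
  have q_ge: "a \<le> q x" if "\<And>t d. 0 \<le> t \<Longrightarrow> d \<in> K \<Longrightarrow> a \<le> p (x + t *\<^sub>R d) - t * r" for a x
    unfolding q_def by (rule cInf_greatest[OF S_ne]) (use that in \<open>auto simp: S_def\<close>)
  have pair: "q (x + y) \<le> (p (x + t *\<^sub>R d) - t * r) + (p (y + s *\<^sub>R e) - s * r)"
    if td: "0 \<le> t" "d \<in> K" "0 \<le> s" "e \<in> K" for x y t d s e
  proof -
    \<comment> \<open>Convexity merges the two moves into one of length \<open>t + s\<close> along
      their weighted mean \<open>w\<close>; if both lengths vanish, any point of \<open>K\<close>
      serves.\<close>
    obtain w where w: "w \<in> K" "(t + s) *\<^sub>R w = t *\<^sub>R d + s *\<^sub>R e"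
    proof (cases "t + s = 0")
      case True
      with td show ?thesis by (intro that[of d]) (auto simp: add_nonneg_eq_0_iff)
    next
      case False
      with td have "t + s > 0" by simp
      then have "(t / (t + s)) *\<^sub>R d + (s / (t + s)) *\<^sub>R e \<in> K"
        using td by (intro convexD[OF K(1)]) (auto simp flip: add_divide_distrib)
      with \<open>t + s > 0\<close> show ?thesis
        by (intro that) (auto simp: scaleR_add_right)
    qed
    have "q (x + y) \<le> p ((x + y) + (t + s) *\<^sub>R w) - (t + s) * r"
      by (rule q_le) (use w td in auto)
    also have "(x + y) + (t + s) *\<^sub>R w = (x + t *\<^sub>R d) + (y + s *\<^sub>R e)"
      unfolding w by simp
    also have "p \<dots> \<le> p (x + t *\<^sub>R d) + p (y + s *\<^sub>R e)"
      by (rule sublinearD(1)[OF p])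
    finally show ?thesis by (simp add: algebra_simps)
  qed
  have "q (x + y) \<le> q x + q y" for x y
  proof -
    have "q (x + y) - q y \<le> q x"
    proof (rule q_ge)
      fix t :: real and d assume td: "0 \<le> t" "d \<in> K"
      have "q (x + y) - (p (x + t *\<^sub>R d) - t * r) \<le> q y"
        by (rule q_ge) (use pair[OF td] in \<open>simp add: algebra_simps\<close>)
      then show "q (x + y) - q y \<le> p (x + t *\<^sub>R d) - t * r" by simp
    qed
    then show ?thesis by simp
  qed
  moreover have "q (c *\<^sub>R x) \<le> c * q x" if c: "c > 0" for c x
  proof -
    have "q (c *\<^sub>R x) / c \<le> q x"
    proof (rule q_ge)
      fix t :: real and d assume td: "0 \<le> t" "d \<in> K"
      have "q (c *\<^sub>R x) \<le> p (c *\<^sub>R x + (c * t) *\<^sub>R d) - (c * t) * r"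
        using q_le td c by simp
      also have "c *\<^sub>R x + (c * t) *\<^sub>R d = c *\<^sub>R (x + t *\<^sub>R d)"
        by (simp add: scaleR_add_right)
      also have "p \<dots> = c * p (x + t *\<^sub>R d)"
        by (rule sublinearD(5)[OF p c])
      finally show "q (c *\<^sub>R x) / c \<le> p (x + t *\<^sub>R d) - t * r"
        using c by (simp add: field_simps)
    qed
    then show ?thesis using c by (simp add: field_simps)
  qed
  ultimately have "sublinear q"
    by (simp add: sublinear_def)
  moreover have "q x \<le> p x" for x
    using q_le[of 0] K(2) by fastforce
  moreover have "q (- d) \<le> - r" if "d \<in> K" for d
    using q_le[of 1 d "- d"] that by (simp add: sublinearD(3)[OF p])
  ultimately show ?thesis by (rule that)
qed

text \<open>Hahn-Banach by Zorn's lemma: a minimal sublinear functional below \<open>p\<close> is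
  odd, since \<open>sublinear_lower_on_convex\<close> with a singleton would otherwise lower it
  further, and an odd sublinear functional is linear.\<close>

lemma exists_linear_le_sublinear:
  assumes p: "sublinear p"
  obtains \<phi> where "linear \<phi>" "\<And>x. \<phi> x \<le> p x"
proof -
  define A where "A = {q. sublinear q \<and> q \<le> p}"
  \<comment> \<open>The order is reversed, so that a maximal element is a minimal
    functional.\<close>
  define P :: "('a \<Rightarrow> real) \<Rightarrow> ('a \<Rightarrow> real) \<Rightarrow> bool" where "P q q' \<longleftrightarrow> q' \<le> q" for q q'
  have "\<exists>m\<in>A. \<forall>a\<in>A. P m a \<longrightarrow> a = m"
  proof (rule predicate_Zorn)
    show "partial_order_on A (relation_of P A)"
      by (rule partial_order_on_relation_ofI) (auto simp: P_def)
  next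
    fix Q assume Q: "Q \<in> Chains (relation_of P A)"
    have QA: "Q \<subseteq> A"
      using Q by (auto simp: Chains_def relation_of_def)
    have tot: "q \<le> q' \<or> q' \<le> q" if "q \<in> Q" "q' \<in> Q" for q q'
      using Q that by (auto simp: Chains_def relation_of_def P_def)
    show "\<exists>u\<in>A. \<forall>a\<in>Q. P a u"
    proof (cases "Q = {}")
      case True
      then show ?thesis using p by (auto simp: A_def)
    next
      case False
      \<comment> \<open>The pointwise infimum of the chain. Subadditivity uses that of two members
        of a chain one lies below both.\<close>
      define u where "u x = (INF q\<in>Q. q x)" for x
      have bdd: "bdd_below ((\<lambda>q. q x) ` Q)" for x
      proof (rule bdd_belowI)
        fix y assume "y \<in> (\<lambda>q. q x) ` Q"
        then obtain q where "y = q x" "sublinear q" "q \<le> p" using QA by (auto simp: A_def)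
        then show "- p (- x) \<le> y"
          using sublinearD(4)[of q x] le_funD[of q p "- x"] by simp
      qed
      have u_le: "u x \<le> q x" if "q \<in> Q" for q x
        unfolding u_def by (rule cINF_lower[OF bdd that])
      have u_ge: "a \<le> u x" if "\<And>q. q \<in> Q \<Longrightarrow> a \<le> q x" for a x
        unfolding u_def by (rule cINF_greatest[OF False that])
      have pair: "u (x + y) \<le> q x + q' y" if qq: "q \<in> Q" "q' \<in> Q" for x y q q'
      proof -
        obtain q'' where q'': "q'' \<in> Q" "q'' \<le> q" "q'' \<le> q'"
          using tot[OF qq] qq by blast
        then have "u (x + y) \<le> q'' (x + y)" by (intro u_le)
        also have "\<dots> \<le> q'' x + q'' y"
          using q'' QA by (intro sublinearD(1)) (auto simp: A_def)
        also have "\<dots> \<le> q x + q' y"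
          using q'' by (simp add: le_fun_def add_mono)
        finally show ?thesis .
      qed
      have "u (x + y) \<le> u x + u y" for x y
      proof -
        have "u (x + y) - u y \<le> u x"
        proof (rule u_ge)
          fix q assume q: "q \<in> Q"
          have "u (x + y) - q x \<le> u y"
            by (rule u_ge) (use pair[OF q] in \<open>simp add: algebra_simps\<close>)
          then show "u (x + y) - u y \<le> q x" by simp
        qed
        then show ?thesis by simp
      qed
      moreover have "u (c *\<^sub>R x) \<le> c * u x" if c: "c > 0" for c x
      proof -
        have "u (c *\<^sub>R x) / c \<le> u x"
        proof (rule u_ge)
          fix q assume q: "q \<in> Q"
          have "u (c *\<^sub>R x) \<le> q (c *\<^sub>R x)" by (rule u_le[OF q])
          also have "\<dots> \<le> c * q x"
            using q QA c by (intro sublinearD(2)) (auto simp: A_def)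
          finally show "u (c *\<^sub>R x) / c \<le> q x" using c by (simp add: field_simps)
        qed
        then show ?thesis using c by (simp add: field_simps)
      qed
      ultimately have "sublinear u" by (simp add: sublinear_def)
      moreover have "u \<le> p"
      proof (rule le_funI)
        fix x
        obtain q where "q \<in> Q" using False by blast
        then show "u x \<le> p x"
          using u_le[of q x] QA le_funD[of q p x] by (fastforce simp: A_def)
      qed
      ultimately show ?thesis
        using u_le by (intro bexI[of _ u]) (auto simp: A_def P_def le_fun_def)
    qed
  qed
  then obtain m where m: "sublinear m" "m \<le> p"
    and min: "\<And>q. sublinear q \<Longrightarrow> q \<le> m \<Longrightarrow> q = m"
    unfolding A_def P_def by (auto intro: order_trans)
  have neg: "m (- d) = - m d" for d
  proof -
    obtain q where "sublinear q" "\<And>x. q x \<le> m x" "q (- d) \<le> - m d"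
      using sublinear_lower_on_convex[OF m(1), of "{d}" "m d"] by auto
    with min[of q] have "m (- d) \<le> - m d" by (auto simp: le_fun_def)
    with sublinearD(4)[OF m(1), of d] show ?thesis by simp
  qed
  have "linear m"
  proof (rule linearI)
    show "m (x + y) = m x + m y" for x y
      using sublinearD(1)[OF m(1), of x y] sublinearD(1)[OF m(1), of "x + y" "- y"]
      by (simp add: neg)
    show "m (c *\<^sub>R x) = c *\<^sub>R m x" for c x
    proof (cases c "0::real" rule: linorder_cases)
      case less
      then show ?thesis
        using sublinearD(5)[OF m(1), of "- c" x] neg[of "c *\<^sub>R x"] by simp
    qed (use sublinearD(3,5)[OF m(1)] in auto)
  qed
  then show ?thesis
    using m(2) by (intro that) (auto simp: le_fun_def)
qed

text \<open>The norm is at least \<open>r\<close> on the translate of \<open>K\<close> by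
  \<open>- x\<close>; it is lowered accordingly, and a linear functional below the result separates.
  With \<open>K = {y}\<close> and \<open>r = norm (y - x)\<close> this yields a functional norming
  \<open>y - x\<close>.\<close>

lemma separating_functional:
  fixes K :: "'a::real_normed_vector set"
  assumes "convex K" and r: "\<And>d. d \<in> K \<Longrightarrow> r \<le> norm (d - x)"
  obtains \<phi> :: "'a \<Rightarrow> real" where "bounded_linear \<phi>" "\<And>y. \<bar>\<phi> y\<bar> \<le> norm y"
    "\<And>d. d \<in> K \<Longrightarrow> \<phi> x + r \<le> \<phi> d"
proof (cases "K = {}")
  case True
  then show ?thesis
    by (intro that[of "\<lambda>_. 0"]) (auto simp: bounded_linear_zero)
next
  case False
  obtain q where q: "sublinear q" "\<And>y. q y \<le> norm y"
      "\<And>d. d \<in> (\<lambda>d. d - x) ` K \<Longrightarrow> q (- d) \<le> - r"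
    using sublinear_lower_on_convex[OF sublinear_norm, of "(\<lambda>d. d - x) ` K" r] False r
      convex_translation_subtract[OF assms(1), of x] by blast
  obtain \<phi> where \<phi>: "linear \<phi>" "\<And>y. \<phi> y \<le> q y"
    using exists_linear_le_sublinear[OF q(1)] by blast
  have le: "\<phi> y \<le> norm y" for y
    using \<phi>(2) q(2) order_trans by blast
  have abs: "\<bar>\<phi> y\<bar> \<le> norm y" for y
    using le[of y] le[of "- y"] linear_neg[OF \<phi>(1), of y] by (simp add: abs_le_iff)
  show ?thesis
  proof (rule that)
    show "bounded_linear \<phi>"
      using \<phi>(1) abs by (intro bounded_linear_intro[where K = 1])
        (auto simp: linear_add linear_scale)
    show "\<bar>\<phi> y\<bar> \<le> norm y" for y by (rule abs)
    show "\<phi> x + r \<le> \<phi> d" if "d \<in> K" for d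
    proof -
      have "\<phi> (- (d - x)) \<le> - r"
        using \<phi>(2) q(3)[of "d - x"] that by (blast intro: order_trans)
      then show ?thesis
        using linear_diff[OF \<phi>(1)] by simp
    qed
  qed
qed

subsection \<open>The weak topology\<close>

lemma continuous_map_weak_topology:
  fixes \<phi> :: "'a::real_normed_vector \<Rightarrow> real"
  assumes "bounded_linear \<phi>"
  shows "continuous_map weak_topology euclidean \<phi>"
proof -
  have "openin weak_topology (\<phi> -` U)" if "open U" for U
    unfolding weak_topology_def using assms that by (auto intro!: topology_generated_by_Basis)
  then show ?thesis
    by (auto simp: continuous_map_def vimage_def)
qed

text \<open>Mazur's theorem: a ball around an outside point misses \<open>K\<close>, so some
  functional is larger on all of \<open>K\<close> by at least the radius, and a weakly open
  half-space contains the point but misses \<open>K\<close>.\<close>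

lemma closedin_weak_topology_convex:
  fixes K :: "'a::real_normed_vector set"
  assumes "closed K" "convex K"
  shows "closedin weak_topology K"
proof -
  have "openin weak_topology (- K)"
  proof (subst openin_subopen, intro ballI)
    fix x assume x: "x \<in> - K"
    then obtain r where r: "r > 0" "ball x r \<subseteq> - K"
      using assms(1) open_contains_ball[of "- K"] by auto
    then have "r \<le> norm (d - x)" if "d \<in> K" for d
      using that by (metis ComplD dist_norm mem_ball norm_minus_commute not_le subsetD)
    then obtain \<phi> :: "'a \<Rightarrow> real" where \<phi>: "bounded_linear \<phi>" "\<And>d. d \<in> K \<Longrightarrow> \<phi> x + r \<le> \<phi> d"
      using separating_functional[OF assms(2), of r x] by metis
    let ?U = "{y \<in> topspace weak_topology. \<phi> y \<in> {..<\<phi> x + r}}"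
    have "openin weak_topology ?U"
      by (rule openin_continuous_map_preimage[OF continuous_map_weak_topology[OF \<phi>(1)]]) simp
    moreover have "x \<in> ?U" using r by simp
    moreover have "?U \<subseteq> - K" using \<phi>(2) by fastforce
    ultimately show "\<exists>U. openin weak_topology U \<and> x \<in> U \<and> U \<subseteq> - K" by blast
  qed
  then show ?thesis
    by (simp add: closedin_def Compl_eq_Diff_UNIV)
qed

text \<open>A functional norming \<open>y - x\<close> takes different values at \<open>x\<close> and
  \<open>y\<close>, so preimages of disjoint open sets of reals separate them.\<close>

lemma Hausdorff_space_weak_topology: "Hausdorff_space (weak_topology :: 'a::real_normed_vector topology)"
  unfolding Hausdorff_space_def
proof (intro allI impI)
  fix x y :: 'a assume "x \<in> topspace weak_topology \<and> y \<in> topspace weak_topology \<and> x \<noteq> y"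
  then obtain \<phi> :: "'a \<Rightarrow> real" where \<phi>: "bounded_linear \<phi>" "\<phi> x + norm (y - x) \<le> \<phi> y"
    using separating_functional[of "{y}" "norm (y - x)" x] convex_singleton by (metis order_refl singletonD singletonI)
  then have "\<phi> x \<noteq> \<phi> y"
    using \<open>_ \<and> _ \<and> x \<noteq> y\<close> by auto
  then obtain U V where "open U" "open V" "\<phi> x \<in> U" "\<phi> y \<in> V" "U \<inter> V = {}"
    using hausdorff by metis
  moreover have "openin weak_topology (\<phi> -` W)" if "open W" for W
    using continuous_map_weak_topology[OF \<phi>(1)] that by (auto simp: continuous_map_def vimage_def)
  ultimately show "\<exists>U V. openin weak_topology U \<and> openin weak_topology V \<and> x \<in> U \<and> y \<in> V \<and> disjnt U V"
    by (intro exI[of _ "\<phi> -` U"] exI[of _ "\<phi> -` V"]) (auto simp: disjnt_def)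
qed

lemma tendsto_imp_limitin_weak_topology:
  assumes "(X \<longlongrightarrow> x) F"
  shows "limitin weak_topology X x F"
  using assms by (auto simp: limitin_weak_topology_iff intro: bounded_linear.tendsto)

lemma closedin_weak_topology_imp_closed:
  assumes "closedin weak_topology K"
  shows "closed K"
  unfolding closed_sequential_limits
proof (intro allI impI)
  fix X x assume "(\<forall>n. X n \<in> K) \<and> X \<longlonglongrightarrow> x"
  then show "x \<in> K"
    using assms
    by (intro limitin_closedin[OF tendsto_imp_limitin_weak_topology[of X x sequentially]]) auto
qed

subsection \<open>Brouwer's theorem on cubes\<close>

lemma tendsto_fun_iff:
  fixes X :: "'b \<Rightarrow> 'i \<Rightarrow> 'a::topological_space"
  shows "(X \<longlongrightarrow> x) F \<longleftrightarrow> (\<forall>i. ((\<lambda>n. X n i) \<longlongrightarrow> x i) F)"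
proof -
  have "(X \<longlongrightarrow> x) F \<longleftrightarrow> limitin (product_topology (\<lambda>i. euclidean) UNIV) X x F"
    by (simp add: euclidean_product_topology)
  then show ?thesis
    by (simp add: limitin_componentwise)
qed

text \<open>Brouwer's theorem with the dimension \<open>n\<close> a term rather than a type; only the first \<open>n\<close>
  coordinates of \<open>g\<close> matter.\<close>

lemma brouwer_coordinates:
  fixes g :: "(nat \<Rightarrow> real) \<Rightarrow> nat \<Rightarrow> real" and n :: nat
  defines "Q \<equiv> UNIV \<rightarrow> {0..1}"
  assumes cont: "\<And>i. i < n \<Longrightarrow> continuous_on Q (\<lambda>x. g x i)"
    and g01: "\<And>x i. x \<in> Q \<Longrightarrow> i < n \<Longrightarrow> g x i \<in> {0..1}"
  obtains x where "x \<in> Q" "\<And>i. i < n \<Longrightarrow> g x i = x i"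
proof -
  \<comment> \<open>Tychonoff's theorem; the cube is metrizable, hence also sequentially
    compact.\<close>
  have "compact (PiE UNIV (\<lambda>_::nat. {0..1::real}))"
    using compactin_PiE[of "\<lambda>_. euclidean" UNIV "\<lambda>_::nat. {0..1::real}"]
    by (simp add: euclidean_product_topology)
  then have "seq_compact Q"
    unfolding Q_def PiE_UNIV_domain compact_eq_seq_compact_metric .
  \<comment> \<open>Grid points of mesh \<open>1 / p\<close>; coordinates from \<open>n\<close> on
    are frozen at 0.\<close>
  define pt where "pt p v = (\<lambda>i. if i < n then real (v i) / real p else 0)" for p and v :: "nat \<Rightarrow> nat"
  \<comment> \<open>Kuhn's labels: 0 where \<open>g\<close> does not decrease coordinate
    \<open>i\<close> and 1 elsewhere, with the face \<open>v i = p\<close> forced to 1 as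
    \<open>kuhn_lemma\<close> demands.\<close>
  define label where "label p v i = (if v i \<noteq> p \<and> pt p v i \<le> g (pt p v) i then 0 else 1::nat)" for p v i
  define near where "near v w \<longleftrightarrow> (\<forall>j<n. v j \<le> w j \<and> w j \<le> v j + (1::nat))" for v w
  have pt_Q: "pt p v \<in> Q" if "p > 0" "\<And>i. i < n \<Longrightarrow> v i \<le> p" for p v
    using that by (auto simp: pt_def Q_def)
  \<comment> \<open>Opposite labels within one grid cell give a corner where \<open>g\<close> does
    not decrease coordinate \<open>i\<close> and another where it does not increase it.\<close>
  have "\<exists>q. (\<forall>i<n. q i < p) \<and> (\<forall>i<n. \<exists>a b. near q a \<and> near q b \<and>
      pt p a i \<le> g (pt p a) i \<and> g (pt p b) i \<le> pt p b i)" if p: "p > 0" for p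
  proof -
    have "\<forall>v. (\<forall>i<n. v i \<le> p) \<longrightarrow> (\<forall>i<n. label p v i = 0 \<or> label p v i = 1)"
      by (auto simp: label_def)
    moreover have "\<forall>v. (\<forall>i<n. v i \<le> p) \<longrightarrow> (\<forall>i<n. v i = 0 \<longrightarrow> label p v i = 0)"
      using g01 pt_Q p by (fastforce simp: label_def pt_def)
    moreover have "\<forall>v. (\<forall>i<n. v i \<le> p) \<longrightarrow> (\<forall>i<n. v i = p \<longrightarrow> label p v i = 1)"
      by (auto simp: label_def)
    ultimately obtain q where q: "\<forall>i<n. q i < p"
      and rs: "\<And>i. i < n \<Longrightarrow> \<exists>r s. near q r \<and> near q s \<and> label p r i \<noteq> label p s i"
      unfolding near_def by (rule kuhn_lemma[OF p, of n "label p"]) blast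
    have "\<exists>a b. near q a \<and> near q b \<and> pt p a i \<le> g (pt p a) i \<and> g (pt p b) i \<le> pt p b i"
      if i: "i < n" for i
    proof -
      obtain a b where ab: "near q a" "near q b" "label p a i = 0" "label p b i = 1"
        using rs[OF i] unfolding label_def by (metis zero_neq_one)
      \<comment> \<open>This serves the face \<open>b i = p\<close>, where label 1 was forced: there
        the coordinate of the point is 1, and \<open>g\<close> is at most 1.\<close>
      have "b j \<le> p" if "j < n" for j
        using ab(2) q that by (fastforce simp: near_def)
      then have "g (pt p b) i \<le> 1"
        using g01 pt_Q[OF p] i by fastforce
      then have "g (pt p b) i \<le> pt p b i"
        using ab(4) i p by (auto simp: label_def pt_def split: if_splits)
      moreover have "pt p a i \<le> g (pt p a) i"
        using ab(3) by (auto simp: label_def split: if_splits)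
      ultimately show ?thesis using ab(1,2) by blast
    qed
    then show ?thesis using q by blast
  qed
  then obtain q where q: "\<And>p i. p > 0 \<Longrightarrow> i < n \<Longrightarrow> q p i < p"
    and ab: "\<And>p i. p > 0 \<Longrightarrow> i < n \<Longrightarrow> \<exists>a b. near (q p) a \<and> near (q p) b \<and>
      pt p a i \<le> g (pt p a) i \<and> g (pt p b) i \<le> pt p b i"
    by metis
  have in_Q: "pt (Suc k) (q (Suc k)) \<in> Q" for k
    using q by (auto intro!: pt_Q less_imp_le)
  obtain x \<rho> where x: "x \<in> Q" and \<rho>: "strict_mono \<rho>"
    and lim: "((\<lambda>k. pt (Suc k) (q (Suc k))) \<circ> \<rho>) \<longlonglongrightarrow> x"
    by (rule seq_compactE[OF \<open>seq_compact Q\<close>]) (use in_Q in auto)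
  define P where "P k = Suc (\<rho> k)" for k
  have P: "P k > 0" "k < P k" for k
    using strict_mono_imp_increasing[OF \<rho>, of k] by (auto simp: P_def)
  \<comment> \<open>Any choice of corners of the shrinking cells has the same limit, as coordinates
    differ by at most \<open>1 / P k\<close>.\<close>
  have lim_near: "(\<lambda>k. pt (P k) (v k)) \<longlonglongrightarrow> x" "\<And>k. pt (P k) (v k) \<in> Q"
    if v: "\<And>k. near (q (P k)) (v k)" for v
  proof -
    have "(\<lambda>k. pt (P k) (v k) i) \<longlonglongrightarrow> x i" for i
    proof (rule Lim_transform2[of "\<lambda>k. pt (P k) (q (P k)) i"])
      show "(\<lambda>k. pt (P k) (q (P k)) i) \<longlonglongrightarrow> x i"
        using lim by (simp add: tendsto_fun_iff P_def o_def)
      show "(\<lambda>k. pt (P k) (q (P k)) i - pt (P k) (v k) i) \<longlonglongrightarrow> 0"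
      proof (rule Lim_null_comparison)
        have "norm (pt (P k) (q (P k)) i - pt (P k) (v k) i) \<le> inverse (real (Suc k))" for k
        proof -
          have "\<bar>real (q (P k) i) - real (v k i)\<bar> \<le> 1" if "i < n"
            using v[of k] that by (auto simp: near_def)
          then have "norm (pt (P k) (q (P k)) i - pt (P k) (v k) i) \<le> 1 / real (P k)"
            using P(1)[of k] by (auto simp: pt_def divide_right_mono simp flip: diff_divide_distrib)
          also have "\<dots> \<le> inverse (real (Suc k))"
            using P(2)[of k] by (simp add: field_simps)
          finally show ?thesis .
        qed
        then show "\<forall>\<^sub>F k in sequentially. norm (pt (P k) (q (P k)) i - pt (P k) (v k) i) \<le> inverse (real (Suc k))"
          by simp
      qed (rule LIMSEQ_inverse_real_of_nat)
    qed
    then show "(\<lambda>k. pt (P k) (v k)) \<longlonglongrightarrow> x" by (simp add: tendsto_fun_iff)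
    have le: "v k i \<le> P k" if "i < n" for k i
      using v[of k] q[OF P(1)[of k] that] that by (auto simp: near_def)
    show "pt (P k) (v k) \<in> Q" for k
      by (rule pt_Q[OF P(1)]) (rule le)
  qed
  have "g x i = x i" if i: "i < n" for i
  proof -
    have g_lim: "(\<lambda>k. g (X k) i) \<longlonglongrightarrow> g x i" if "X \<longlonglongrightarrow> x" "\<And>k. X k \<in> Q" for X
      using cont[OF i] that x unfolding continuous_on_sequentially by (auto simp: o_def)
    have x_lim: "(\<lambda>k. X k i) \<longlonglongrightarrow> x i" if "X \<longlonglongrightarrow> x" for X
      using that by (simp add: tendsto_fun_iff)
    obtain a b where a: "\<And>k. near (q (P k)) (a k)" "\<And>k. pt (P k) (a k) i \<le> g (pt (P k) (a k)) i"
      and b: "\<And>k. near (q (P k)) (b k)" "\<And>k. g (pt (P k) (b k)) i \<le> pt (P k) (b k) i"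
      using ab[OF P(1) i] by metis
    show ?thesis
    proof (rule antisym)
      show "g x i \<le> x i"
        using b lim_near[OF b(1)] by (intro LIMSEQ_le[OF g_lim x_lim]) auto
      show "x i \<le> g x i"
        using a lim_near[OF a(1)] by (intro LIMSEQ_le[OF x_lim g_lim]) auto
    qed
  qed
  with x show ?thesis by (rule that)
qed

subsection \<open>Separability\<close>

text \<open>Countably many norming functionals, one for each pair of points of \<open>A\<close>,
  suffice: by approximation they also separate points of the closure.\<close>

lemma separating_sequence:
  fixes A :: "'a::real_normed_vector set"
  assumes "countable A"
  obtains \<Phi> :: "nat \<Rightarrow> 'a \<Rightarrow> real" where "\<And>k. bounded_linear (\<Phi> k)"
    "\<And>x y. x \<in> closure A \<Longrightarrow> y \<in> closure A \<Longrightarrow> (\<And>k. \<Phi> k x = \<Phi> k y) \<Longrightarrow> x = y"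
proof (cases "A = {}")
  case True
  then show ?thesis
    by (intro that[of "\<lambda>_ _. 0"]) (auto simp: bounded_linear_zero)
next
  case False
  have "\<exists>\<phi> :: 'a \<Rightarrow> real. bounded_linear \<phi> \<and> (\<forall>y. \<bar>\<phi> y\<bar> \<le> norm y) \<and> norm (a - b) \<le> \<phi> (a - b)" for a b
  proof -
    obtain \<phi> :: "'a \<Rightarrow> real" where \<phi>: "bounded_linear \<phi>" "\<And>y. \<bar>\<phi> y\<bar> \<le> norm y"
        "\<phi> b + norm (a - b) \<le> \<phi> a"
      by (rule separating_functional[of "{a}" "norm (a - b)" b]) auto
    then show ?thesis
      by (intro exI[of _ \<phi>]) (simp add: linear_diff[OF bounded_linear.linear])
  qed
  then obtain \<psi> :: "'a \<Rightarrow> 'a \<Rightarrow> 'a \<Rightarrow> real" where \<psi>: "\<And>a b. bounded_linear (\<psi> a b)"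
      "\<And>a b y. \<bar>\<psi> a b y\<bar> \<le> norm y" "\<And>a b. norm (a - b) \<le> \<psi> a b (a - b)"
    by metis
  define e where "e = from_nat_into (A \<times> A)"
  have range: "range e = A \<times> A"
    unfolding e_def using assms False by (intro range_from_nat_into) auto
  show ?thesis
  proof (rule that[of "\<lambda>k. \<psi> (fst (e k)) (snd (e k))"])
    fix x y assume xy: "x \<in> closure A" "y \<in> closure A"
      and eq: "\<And>k. \<psi> (fst (e k)) (snd (e k)) x = \<psi> (fst (e k)) (snd (e k)) y"
    show "x = y"
    proof (rule ccontr)
      assume "x \<noteq> y"
      \<comment> \<open>Equal functional values force \<open>norm (a - b)\<close> below two fifths
        of \<open>norm (x - y)\<close>, which would make \<open>norm (x - y)\<close> less than four
        fifths of itself.\<close>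
      then have "norm (x - y) / 5 > 0" by simp
      then obtain a b where ab: "a \<in> A" "b \<in> A" "dist a x < norm (x - y) / 5" "dist b y < norm (x - y) / 5"
        using xy by (meson closure_approachable)
      obtain k where "e k = (a, b)"
        using range ab by (metis SigmaI rangeE)
      then have "\<psi> a b x = \<psi> a b y" using eq[of k] by simp
      then have "\<psi> a b (a - b) = \<psi> a b (a - x) - \<psi> a b (b - y)"
        by (simp add: linear_diff[OF bounded_linear.linear[OF \<psi>(1)]])
      also have "\<dots> \<le> norm (a - x) + norm (b - y)"
        using \<psi>(2)[of a b "a - x"] \<psi>(2)[of a b "b - y"] by linarith
      finally have "norm (a - b) \<le> norm (a - x) + norm (b - y)"
        using \<psi>(3)[of a b] by linarith
      moreover have "norm (x - y) \<le> norm (a - x) + norm (a - b) + norm (b - y)"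
        by norm
      ultimately show False
        using ab(3,4) \<open>norm (x - y) / 5 > 0\<close> unfolding dist_norm by linarith
    qed
  qed (use \<psi>(1) in auto)
qed

text \<open>The map \<open>x \<mapsto> (\<Phi> k x)\<^sub>k\<close> embeds \<open>K\<close> with its weak topology into the metrizable space
  \<open>\<real>\<^sup>\<nat>\<close>.\<close>

lemma weakly_compact_imp_sequentially_compact:
  fixes K :: "'a::real_normed_vector set" and \<Phi> :: "nat \<Rightarrow> 'a \<Rightarrow> real"
  assumes K: "compactin weak_topology K"
    and \<Phi>: "\<And>k. bounded_linear (\<Phi> k)"
    and sep: "\<And>x y. x \<in> K \<Longrightarrow> y \<in> K \<Longrightarrow> (\<And>k. \<Phi> k x = \<Phi> k y) \<Longrightarrow> x = y"
    and X: "\<And>n::nat. X n \<in> K"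
  obtains z r where "z \<in> K" "strict_mono r" "limitin weak_topology (X \<circ> r) z sequentially"
proof -
  define W where "W = subtopology weak_topology K"
  define T where "T x k = \<Phi> k x" for x k
  have topW: "topspace W = K" by (simp add: W_def)
  have cont: "continuous_map W euclidean T"
    unfolding euclidean_product_topology[symmetric] continuous_map_componentwise_UNIV
    by (auto simp: T_def W_def intro!: continuous_map_from_subtopology continuous_map_weak_topology \<Phi>)
  have cW: "compact_space W"
    using K by (simp add: W_def compact_space_subtopology)
  then have "compact (T ` K)"
    using image_compactin[OF _ cont, of K] by (simp add: compact_space_def topW)
  then have "seq_compact (T ` K)"
    unfolding compact_eq_seq_compact_metric .
  then obtain l r where l: "l \<in> T ` K" and r: "strict_mono r" and lim: "((\<lambda>n. T (X n)) \<circ> r) \<longlonglongrightarrow> l"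
    by (rule seq_compactE) (use X in auto)
  obtain z where z: "z \<in> K" "l = T z" using l by blast
  \<comment> \<open>A continuous injection of a compact space into a Hausdorff space is a
    homeomorphism onto its image; the inverse turns coordinatewise convergence back into weak
    convergence.\<close>
  have "homeomorphic_map W (top_of_set (T ` K)) T"
  proof (rule continuous_imp_homeomorphic_map[OF _ cW])
    show "continuous_map W (top_of_set (T ` K)) T"
      using cont by (auto simp: continuous_map_in_subtopology topW)
    show "inj_on T (topspace W)"
      using sep by (auto simp: topW inj_on_def T_def fun_eq_iff)
  qed (auto simp: topW Hausdorff_space_subtopology)
  then obtain S where S: "continuous_map (top_of_set (T ` K)) W S" "\<And>x. x \<in> K \<Longrightarrow> S (T x) = x"
    by (auto simp: homeomorphic_map_maps homeomorphic_maps_def topW)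
  have "limitin (top_of_set (T ` K)) ((\<lambda>n. T (X n)) \<circ> r) (T z) sequentially"
    using lim z X by (auto simp: limitin_subtopology)
  from continuous_map_limit[OF S(1) this]
  have "limitin weak_topology (X \<circ> r) z sequentially"
    using S(2) X z(1) by (simp add: o_def W_def limitin_subtopology)
  with z(1) r show ?thesis by (rule that)
qed

section \<open>Demicontinuity and strong continuity along sequences\<close>

lemma demicontinuous_onD:
  assumes "demicontinuous_on C f" "\<And>n::nat. X n \<in> C" "x \<in> C" "X \<longlonglongrightarrow> x"
  shows "limitin weak_topology (\<lambda>n. f (X n)) (f x) sequentially"
  using assms by (simp add: demicontinuous_on_def)

lemma strongly_continuous_onD:
  assumes "strongly_continuous_on C f" "\<And>n::nat. X n \<in> C" "x \<in> C"
    and "limitin weak_topology X x sequentially"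
  shows "(\<lambda>n. f (X n)) \<longlonglongrightarrow> f x"
  using assms by (simp add: strongly_continuous_on_def)

text \<open>The norm topology on the domain is metrizable, so testing on sequences suffices.\<close>

lemma demicontinuous_on_imp_continuous_on_functional:
  fixes \<phi> :: "'a::real_normed_vector \<Rightarrow> real"
  assumes "demicontinuous_on C f" "bounded_linear \<phi>"
  shows "continuous_on C (\<lambda>x. \<phi> (f x))"
  unfolding continuous_on_sequentially
  using assms by (auto simp: demicontinuous_on_def limitin_weak_topology_iff o_def)

lemma demicontinuous_on_subset:
  "demicontinuous_on C f \<Longrightarrow> D \<subseteq> C \<Longrightarrow> demicontinuous_on D f"
  unfolding demicontinuous_on_def by (meson subsetD)

text \<open>Close a point under \<open>f\<close> and rational convex combinations; the closure stays invariant
  since closed convex sets are weakly closed.\<close>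

lemma separable_invariant_convex_subset:
  fixes C :: "'a::real_normed_vector set"
  assumes C: "C \<noteq> {}" "closed C" "convex C" and f: "f \<in> C \<rightarrow> C" "demicontinuous_on C f"
  obtains A where "countable A" "A \<noteq> {}" "closure A \<subseteq> C" "convex (closure A)"
    "f \<in> closure A \<rightarrow> closure A"
proof -
  obtain x0 where x0: "x0 \<in> C" using C(1) by blast
  define h where "h = (\<lambda>(t::real, x::'a, y). (1 - t) *\<^sub>R x + t *\<^sub>R y)"
  \<comment> \<open>Rational weights keep the generated set countable; their density in the unit
    interval makes the closure convex.\<close>
  define I where "I = {0..1::real} \<inter> \<rat>"
  define B where "B = rec_nat {x0} (\<lambda>_ S. S \<union> f ` S \<union> h ` (I \<times> S \<times> S))"
  have B_simps: "B 0 = {x0}" "B (Suc n) = B n \<union> f ` B n \<union> h ` (I \<times> B n \<times> B n)" for n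
    by (simp_all add: B_def)
  define A where "A = (\<Union>n. B n)"
  have B_mono: "B m \<subseteq> B n" if "m \<le> n" for m n
    by (rule lift_Suc_mono_le[of B, OF _ that]) (auto simp: B_simps)
  have "countable I"
    unfolding I_def using countable_rat by (rule countable_subset[rotated]) auto
  then have "countable (B n)" for n
    by (induction n) (auto simp: B_simps)
  then have "countable A" by (simp add: A_def)
  have "B n \<subseteq> C" for n
  proof (induction n)
    case (Suc n)
    have "h (t, x, y) \<in> C" if "t \<in> I" "x \<in> B n" "y \<in> B n" for t x y
      using that Suc unfolding h_def prod.case by (intro convexD[OF C(3)]) (auto simp: I_def)
    moreover have "f x \<in> C" if "x \<in> B n" for x
      using that Suc f(1) by blast
    ultimately show ?case
      using Suc by (auto simp: B_simps)
  qed (simp add: B_simps x0)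
  then have "A \<subseteq> C" by (auto simp: A_def)
  then have "closure A \<subseteq> C" using C(2) by (rule closure_minimal)
  have fA: "f x \<in> A" if xA: "x \<in> A" for x
  proof -
    obtain n where "x \<in> B n" using xA by (auto simp: A_def)
    then have "f x \<in> B (Suc n)" by (simp add: B_simps)
    then show ?thesis unfolding A_def by blast
  qed
  have hA: "h ` (I \<times> A \<times> A) \<subseteq> A"
  proof clarify
    fix t x y assume t: "t \<in> I" and "x \<in> A" "y \<in> A"
    then obtain m n where "x \<in> B m" "y \<in> B n" by (auto simp: A_def)
    then have "x \<in> B (max m n)" "y \<in> B (max m n)"
      using B_mono[of m "max m n"] B_mono[of n "max m n"] by auto
    with t have "h (t, x, y) \<in> B (Suc (max m n))" by (auto simp: B_simps)
    then show "h (t, x, y) \<in> A" unfolding A_def by blast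
  qed
  have "closure I = {0..1}"
    unfolding I_def by (subst closure_convex_Int_superset) (auto simp: Rats_closure_real)
  then have "closure (I \<times> A \<times> A) = {0..1} \<times> closure A \<times> closure A"
    by (simp add: closure_Times)
  moreover have "continuous_on S h" for S
    unfolding h_def case_prod_unfold by (intro continuous_intros)
  ultimately have "h ` ({0..1} \<times> closure A \<times> closure A) \<subseteq> closure A"
    using image_closure_subset[of "I \<times> A \<times> A" h "closure A"] hA closure_subset[of A] by auto
  then have "convex (closure A)"
    unfolding convex_alt by (force simp: h_def)
  have "f x \<in> closure A" if x: "x \<in> closure A" for x
  proof -
    obtain X where X: "\<And>n::nat. X n \<in> A" "X \<longlonglongrightarrow> x"
      using x unfolding closure_sequential by blast
    have lim: "limitin weak_topology (\<lambda>n. f (X n)) (f x) sequentially"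
      by (rule demicontinuous_onD[OF f(2)]) (use X \<open>A \<subseteq> C\<close> \<open>closure A \<subseteq> C\<close> x in auto)
    have "f (X n) \<in> closure A" for n
      using fA[OF X(1)] closure_subset by blast
    then show ?thesis
      using \<open>convex (closure A)\<close>
      by (intro limitin_closedin[OF lim closedin_weak_topology_convex]) auto
  qed
  moreover have "A \<noteq> {}"
    using B_simps(1) by (auto simp: A_def)
  ultimately show ?thesis
    using \<open>countable A\<close> \<open>closure A \<subseteq> C\<close> \<open>convex (closure A)\<close> by (intro that) auto
qed

subsection \<open>Weak approximate fixed points\<close>

text \<open>Brouwer's theorem is applied to barycentric weights over the net rather than to points
  of \<open>D\<close>. Demicontinuity suffices because \<open>f\<close> enters only through the
  functionals \<open>\<Phi> k\<close>.\<close>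

lemma weak_approximate_fixed_point:
  fixes D :: "'a::real_normed_vector set" and \<Phi> :: "nat \<Rightarrow> 'a \<Rightarrow> real"
  assumes D: "D \<noteq> {}" "compactin weak_topology D" "convex D"
    and f: "f \<in> D \<rightarrow> D" "demicontinuous_on D f"
    and \<Phi>: "\<And>k. bounded_linear (\<Phi> k)" and \<delta>: "\<delta> > 0"
  obtains x where "x \<in> D" "\<And>k. k < m \<Longrightarrow> \<bar>\<Phi> k x - \<Phi> k (f x)\<bar> \<le> \<delta>"
proof -
  define \<rho> where "\<rho> x y = (\<Sum>k<m. \<bar>\<Phi> k x - \<Phi> k y\<bar>)" for x y
  \<comment> \<open>Balls of the seminorm are weakly open, so weak compactness leaves a finite
    net.\<close>
  define U where "U c = {y \<in> topspace weak_topology. \<rho> y c \<in> {..<\<delta>}}" for c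
  have "continuous_map weak_topology euclideanreal (\<lambda>y. \<rho> y c)" for c
    unfolding \<rho>_def
    by (intro continuous_map_sum continuous_map_real_abs continuous_map_diff
        continuous_map_weak_topology \<Phi> continuous_map_const[THEN iffD2]) auto
  then have "openin weak_topology (U c)" for c
    unfolding U_def by (rule openin_continuous_map_preimage) simp
  moreover have "D \<subseteq> \<Union> (U ` D)"
    using \<delta> by (auto simp: U_def \<rho>_def)
  ultimately obtain F where F: "finite F" "F \<subseteq> U ` D" "D \<subseteq> \<Union> F"
    using D(2) unfolding compactin_def by (metis (no_types, lifting) imageE)
  then obtain E where E: "finite E" "E \<subseteq> D" "F = U ` E"
    by (metis finite_subset_image)
  obtain c :: "nat \<Rightarrow> 'a" and N where c: "E = c ` {..<N}"
    using finite_imp_nat_seg_image_inj_on[OF E(1)] by (metis lessThan_def)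
  have cD: "c i \<in> D" if "i < N" for i using E c that by blast
  have net: "\<exists>i<N. \<rho> y (c i) < \<delta>" if "y \<in> D" for y
    using F(3) that unfolding E(3) c U_def by auto
  have "N > 0" using net D(1) by fastforce

  \<comment> \<open>Schauder weights: \<open>w i\<close> is nonzero exactly within seminorm distance
    \<open>\<delta>\<close> of \<open>c i\<close>, and the net property makes the total
    \<open>V\<close> positive on \<open>D\<close>.\<close>
  define w where "w i y = max 0 (\<delta> - \<rho> y (c i))" for i y
  define V where "V y = (\<Sum>i<N. w i y)" for y
  have w0: "w i y \<ge> 0" for i y by (simp add: w_def)
  have V: "V y > 0" if y: "y \<in> D" for y
  proof -
    obtain i where "i < N" "w i y > 0"
      using net[OF y] by (auto simp: w_def)
    then show ?thesis
      unfolding V_def using w0 by (intro sum_pos2[of _ i]) auto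
  qed
  define s where "s t = (\<Sum>i<N. t i)" for t :: "nat \<Rightarrow> real"
  \<comment> \<open>The weights \<open>u t\<close> are convex on all of the cube and agree with \<open>t\<close> on the simplex.\<close>
  define u where "u t i = (t i + (if i = 0 then max 0 (1 - s t) else 0)) / max 1 (s t)" for t and i :: nat
  define X where "X t = (\<Sum>i<N. u t i *\<^sub>R c i)" for t
  define Q where "Q = (UNIV \<rightarrow> {0..1} :: (nat \<Rightarrow> real) set)"
  have X_D: "X t \<in> D" if "t \<in> Q" for t
    unfolding X_def
  proof (rule convex_sum[OF _ D(3)])
    have "(\<Sum>i<N. t i + (if i = 0 then max 0 (1 - s t) else 0)) = max 1 (s t)"
      using \<open>N > 0\<close> by (simp add: sum.distrib s_def)
    then show "(\<Sum>i<N. u t i) = 1"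
      unfolding u_def sum_divide_distrib[symmetric] by simp
    show "u t i \<ge> 0" for i
      using that by (auto simp: u_def Q_def Pi_iff intro!: divide_nonneg_pos add_nonneg_nonneg)
  qed (use cD in auto)
  have coord: "continuous_on Q (\<lambda>t. t i)" for i
    by (rule continuous_on_subset[OF continuous_on_product_coordinates]) simp
  have X_cont: "continuous_on Q X"
  proof -
    have "continuous_on Q (\<lambda>t. if i = 0 then max 0 (1 - s t) else 0)" for i :: nat
      unfolding s_def by (cases "i = 0") (auto intro!: continuous_intros coord)
    moreover have "continuous_on Q s"
      unfolding s_def by (intro continuous_intros coord)
    ultimately show ?thesis
      unfolding X_def u_def by (intro continuous_intros coord) auto
  qed
  have fX: "f (X t) \<in> D" if "t \<in> Q" for t using f(1) X_D[OF that] by blast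
  have \<Phi>_cont: "continuous_on Q (\<lambda>t. \<Phi> k (f (X t)))" for k
    by (rule continuous_on_compose2[OF demicontinuous_on_imp_continuous_on_functional[OF f(2) \<Phi>] X_cont])
      (use X_D in auto)
  have w_cont: "continuous_on Q (\<lambda>t. w i (f (X t)))" for i
    unfolding w_def \<rho>_def by (intro continuous_intros \<Phi>_cont)
  \<comment> \<open>Weights \<open>t\<close> go to the normalized Schauder weights of
    \<open>f (X t)\<close>. The first \<open>N\<close> coordinates at a fixed point thus sum to 1,
    where \<open>u t\<close> agrees with \<open>t\<close>.\<close>
  define g where "g t i = w i (f (X t)) / V (f (X t))" for t i
  obtain t where t: "t \<in> Q" and gt: "\<And>i. i < N \<Longrightarrow> g t i = t i"
  proof (rule brouwer_coordinates[of N g, folded Q_def])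
    fix i assume i: "i < N"
    show "continuous_on Q (\<lambda>t. g t i)"
      unfolding g_def V_def
      by (intro continuous_intros w_cont) (use V fX in \<open>force simp: V_def\<close>)
    show "g t i \<in> {0..1}" if "t \<in> Q" for t
    proof -
      have "w i (f (X t)) \<le> V (f (X t))"
        unfolding V_def using i w0 by (intro member_le_sum) auto
      then show ?thesis
        using V[OF fX[OF that]] w0 by (simp add: g_def)
    qed
  qed blast
  define x where "x = X t"
  have fx: "f x \<in> D" using fX t by (simp add: x_def)
  have "s t = (\<Sum>i<N. g t i)"
    using gt by (simp add: s_def)
  also have "\<dots> = 1"
    using V[OF fx] unfolding g_def sum_divide_distrib[symmetric] V_def[symmetric] x_def by simp
  finally have s1: "s t = 1" .
  then have "u t i = t i" for i
    by (simp add: u_def)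
  then have x: "x = (\<Sum>i<N. t i *\<^sub>R c i)"
    by (simp add: x_def X_def)
  have "\<bar>\<Phi> k x - \<Phi> k (f x)\<bar> \<le> \<delta>" if k: "k < m" for k
  proof -
    \<comment> \<open>As the weights sum to 1, the difference is a weighted mean of differences with
      net points.\<close>
    have "\<Phi> k x - \<Phi> k (f x) = (\<Sum>i<N. t i * \<Phi> k (c i)) - (\<Sum>i<N. t i) * \<Phi> k (f x)"
      using s1 by (simp add: x s_def linear_sum[OF bounded_linear.linear[OF \<Phi>]]
        linear_scale[OF bounded_linear.linear[OF \<Phi>]])
    also have "\<dots> = (\<Sum>i<N. t i * (\<Phi> k (c i) - \<Phi> k (f x)))"
      by (simp add: sum_distrib_right sum_subtractf algebra_simps)
    also have "\<bar>\<dots>\<bar> \<le> (\<Sum>i<N. t i * \<delta>)"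
    proof (rule order_trans[OF sum_abs sum_mono])
      fix i assume "i \<in> {..<N}"
      then have i: "i < N" by simp
      have ti: "t i \<ge> 0" using t by (auto simp: Q_def)
      show "\<bar>t i * (\<Phi> k (c i) - \<Phi> k (f x))\<bar> \<le> t i * \<delta>"
      proof (cases "t i = 0")
        case False
        \<comment> \<open>Only net points closer than \<open>\<delta>\<close> to \<open>f x\<close>
          carry weight.\<close>
        then have "w i (f x) \<noteq> 0"
          using gt[OF i] by (auto simp: g_def x_def)
        then have "\<rho> (f x) (c i) < \<delta>"
          by (auto simp: w_def max_def split: if_splits)
        moreover have "\<bar>\<Phi> k (f x) - \<Phi> k (c i)\<bar> \<le> \<rho> (f x) (c i)"
          unfolding \<rho>_def by (rule member_le_sum) (use k in auto)
        ultimately show ?thesis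
          using ti by (auto simp: abs_mult abs_minus_commute intro!: mult_left_mono)
      qed simp
    qed
    also have "\<dots> = \<delta>"
      using s1 by (simp add: s_def flip: sum_distrib_right)
    finally show ?thesis .
  qed
  moreover have "x \<in> D" using X_D t by (simp add: x_def)
  ultimately show ?thesis by (intro that)
qed

text \<open>On a separable invariant set, the first \<open>n\<close> separating functionals are
  controlled up to \<open>1 / (n + 1)\<close>. Weakly convergent subsequences of the points and of
  their images then have limits that no functional of the family tells apart.\<close>

lemma weak_approximate_fixed_point_sequence:
  fixes C :: "'a::real_normed_vector set"
  assumes C: "C \<noteq> {}" "compactin weak_topology C" "convex C"
    and f: "f \<in> C \<rightarrow> C" "demicontinuous_on C f"
  obtains X x where "\<And>n::nat. X n \<in> C" "x \<in> C" "limitin weak_topology X x sequentially"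
    "limitin weak_topology (\<lambda>n. f (X n)) x sequentially"
proof -
  \<comment> \<open>Compact sets are closed in the Hausdorff weak topology, hence closed in
    norm.\<close>
  have "closed C"
    using compactin_imp_closedin[OF Hausdorff_space_weak_topology C(2)]
    by (rule closedin_weak_topology_imp_closed)
  then obtain A where A: "countable A" "A \<noteq> {}" "closure A \<subseteq> C" "convex (closure A)"
    "f \<in> closure A \<rightarrow> closure A"
    using separable_invariant_convex_subset[OF C(1) _ C(3) f] by blast
  define D where "D = closure A"
  have "compactin weak_topology (D \<inter> C)"
    unfolding D_def by (intro closed_Int_compactin closedin_weak_topology_convex A C(2)) simp
  then have D: "D \<noteq> {}" "compactin weak_topology D" "convex D" "D \<subseteq> C" "f \<in> D \<rightarrow> D"
    using A by (auto simp: D_def Int_absorb2)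
  have fD: "demicontinuous_on D f"
    using f(2) D(4) by (rule demicontinuous_on_subset)
  obtain \<Phi> :: "nat \<Rightarrow> 'a \<Rightarrow> real" where \<Phi>: "\<And>k. bounded_linear (\<Phi> k)"
    and sep: "\<And>x y. x \<in> D \<Longrightarrow> y \<in> D \<Longrightarrow> (\<And>k. \<Phi> k x = \<Phi> k y) \<Longrightarrow> x = y"
    using separating_sequence[OF A(1)] unfolding D_def by metis
  have "\<exists>x\<in>D. \<forall>k<n. \<bar>\<Phi> k x - \<Phi> k (f x)\<bar> \<le> inverse (real (Suc n))" for n
    by (rule weak_approximate_fixed_point[where \<Phi> = \<Phi> and m = n, OF D(1-3,5) fD \<Phi>]) auto
  then obtain Y where Y: "\<And>n. Y n \<in> D"
    and approx: "\<And>n k. k < n \<Longrightarrow> \<bar>\<Phi> k (Y n) - \<Phi> k (f (Y n))\<bar> \<le> inverse (real (Suc n))"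
    by metis
  have fY: "f (Y n) \<in> D" for n using Y D(5) by blast
  have subseq: "\<exists>z r. z \<in> D \<and> strict_mono r \<and> limitin weak_topology (Z \<circ> r) z sequentially"
    if "\<And>n. Z n \<in> D" for Z :: "nat \<Rightarrow> 'a"
    by (rule weakly_compact_imp_sequentially_compact[where \<Phi> = \<Phi> and X = Z,
        OF D(2) \<Phi> sep that]) blast+
  obtain x r where x: "x \<in> D" "strict_mono r" "limitin weak_topology (Y \<circ> r) x sequentially"
    using subseq[of Y] Y by blast
  \<comment> \<open>A second extraction, for the images along the first subsequence.\<close>
  obtain y r' where y: "y \<in> D" "strict_mono r'"
    "limitin weak_topology ((\<lambda>n. f ((Y \<circ> r) n)) \<circ> r') y sequentially"
    using subseq[of "\<lambda>n. f ((Y \<circ> r) n)"] fY by auto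
  define q where "q = r \<circ> r'"
  have q: "strict_mono q" using x(2) y(2) by (simp add: q_def strict_mono_o)
  have xq: "limitin weak_topology (Y \<circ> q) x sequentially"
    using limitin_subsequence[OF y(2) x(3)] by (simp add: q_def o_assoc)
  have yq: "limitin weak_topology (\<lambda>n. f ((Y \<circ> q) n)) y sequentially"
    using y(3) by (simp add: q_def o_def)
  have "\<Phi> k x = \<Phi> k y" for k
  proof -
    \<comment> \<open>For fixed \<open>k\<close> the tolerance bound applies once
      \<open>n > k\<close>.\<close>
    have "(\<lambda>n. \<Phi> k (Y n) - \<Phi> k (f (Y n))) \<longlonglongrightarrow> 0"
      by (rule Lim_null_comparison[OF eventually_mono[OF eventually_gt_at_top[of k]]
          LIMSEQ_inverse_real_of_nat]) (simp only: real_norm_def approx)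
    then have "(\<lambda>n. \<Phi> k ((Y \<circ> q) n) - \<Phi> k (f ((Y \<circ> q) n))) \<longlonglongrightarrow> 0"
      using LIMSEQ_subseq_LIMSEQ[OF _ q] by (fastforce simp: o_def)
    moreover have "(\<lambda>n. \<Phi> k ((Y \<circ> q) n) - \<Phi> k (f ((Y \<circ> q) n))) \<longlonglongrightarrow> \<Phi> k x - \<Phi> k y"
      using xq yq \<Phi> by (intro tendsto_diff) (auto simp: limitin_weak_topology_iff)
    ultimately show ?thesis
      using LIMSEQ_unique by fastforce
  qed
  then have "y = x" using sep x(1) y(1) by metis
  then show ?thesis
    using that[of "Y \<circ> q" x] xq yq Y x(1) D(4) by auto
qed

section \<open>From a weak approximate fixed point sequence to a fixed point\<close>

theorem corollary3p4:
  fixes C :: "'a::banach set" and f :: "'a \<Rightarrow> 'a" and m :: nat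
  assumes "C \<noteq> {}"
    and "compactin weak_topology C"
    and "convex C"
    and "f \<in> C \<rightarrow> C"
    and "demicontinuous_on C f"
    and "m \<ge> 1"
    and "strongly_continuous_on C (f ^^ m)"
  shows "\<exists>x\<in>C. f x = x"
proof -
  obtain X x where X: "\<And>n::nat. X n \<in> C" and x: "x \<in> C"
    and lim: "limitin weak_topology X x sequentially"
      "limitin weak_topology (\<lambda>n. f (X n)) x sequentially"
    using weak_approximate_fixed_point_sequence[OF assms(1-5)] by blast
  define z where "z = (f ^^ m) x"
  have iter: "(f ^^ m) y \<in> C" if "y \<in> C" for y
    using assms(4) that by (induction m) auto
  \<comment> \<open>Strong continuity upgrades weak convergence to norm convergence, which is what
    demicontinuity at \<open>z\<close> needs.\<close>
  have "(\<lambda>n. (f ^^ m) (X n)) \<longlonglongrightarrow> z"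
    unfolding z_def by (rule strongly_continuous_onD[OF assms(7) X x lim(1)])
  then have lim_fz: "limitin weak_topology (\<lambda>n. f ((f ^^ m) (X n))) (f z) sequentially"
    by (intro demicontinuous_onD[OF assms(5)]) (simp_all add: z_def iter X x)
  have "f (X n) \<in> C" for n
    using assms(4) X by blast
  then have "(\<lambda>n. (f ^^ m) (f (X n))) \<longlonglongrightarrow> z"
    unfolding z_def by (rule strongly_continuous_onD[OF assms(7) _ x lim(2)])
  \<comment> \<open>Since \<open>f\<close> commutes with its iterate, this is the sequence of
    \<open>lim_fz\<close>; its weak limit is unique.\<close>
  then have "limitin weak_topology (\<lambda>n. f ((f ^^ m) (X n))) z sequentially"
    by (simp add: tendsto_imp_limitin_weak_topology funpow_swap1)
  with lim_fz have "f z = z"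
    by (rule limitin_Hausdorff_unique[OF _ _ _ Hausdorff_space_weak_topology]) simp
  then show ?thesis
    using iter x z_def by blast
qed

end
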